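(* Let $(Q,\ast)$ be a quasigroup, let $\tau\in S_3$, and let $(Q,\circ)$ be the $\tau$-parastrophe of $(Q,\ast)$, i.e. $\circ=\ast^{\tau}$. Let $\theta=(\tau,(\varepsilon,\varepsilon,\varepsilon))$. For $j\in\{1,2,3\}$ put $v(1)=r$, $v(2)=l$, $v(3)=m$. Then for all $\sigma\in S_3$ the following hold. (1) With $v=v(\tau^{-1}2)$: ${}^{\sigma}N_l^{\circ}=\theta^{-1}\;{}^{\tau\sigma\tau^{-1}}N_v^{\ast}\;\theta$; further, ${}^{\sigma}_{1}N_l^{\circ}={}^{\tau\sigma\tau^{-1}}_{\tau^{-1}1}N_v^{\ast}$ and ${}^{\sigma}_{3}N_l^{\circ}={}^{\tau\sigma\tau^{-1}}_{\tau^{-1}3}N_v^{\ast}$. (2) With $v=v(\tau^{-1}1)$: ${}^{\sigma}N_r^{\circ}=\theta^{-1}\;{}^{\tau\sigma\tau^{-1}}N_v^{\ast}\;\theta$; further, ${}^{\sigma}_{2}N_r^{\circ}={}^{\tau\sigma\tau^{-1}}_{\tau^{-1}2}N_v^{\ast}$ and ${}^{\sigma}_{3}N_r^{\circ}={}^{\tau\sigma\tau^{-1}}_{\tau^{-1}3}N_v^{\ast}$. (3) With $v=v(\tau^{-1}3)$: ${}^{\sigma}N_m^{\circ}=\theta^{-1}\;{}^{\tau\sigma\tau^{-1}}N_v^{\ast}\;\theta$; further, ${}^{\sigma}_{1}N_m^{\circ}={}^{\tau\sigma\tau^{-1}}_{\tau^{-1}1}N_v^{\ast}$ and ${}^{\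sigma}_{2}N_m^{\circ}={}^{\tau\sigma\tau^{-1}}_{\tau^{-1}2}N_v^{\ast}$.
   Context: A quasigroup $(Q,A)$ is a set $Q$ with a binary operation $A$ such that for all $a,b\in Q$ the equations $A(x,a)=b$ and $A(a,y)=b$ have unique solutions $x,y\in Q$. (In the claim, operations are written $\ast$ and $\circ$.) Conventions. Products in $S_3$ are computed from left to right, i.e. $(\sigma\tau)i=\tau(\sigma i)$, and $\sigma i$ is the image of $i$ under $\sigma$; $\varepsilon$ denotes an identity permutation (of $Q$ or in $S_3$). Permutations of $Q$ are composed as functions, $(\alpha\beta)(x)=\alpha(\beta(x))$. Triples of permutations of $Q$ are multiplied and inverted componentwise. For a triple $R=(\alpha_1,\alpha_2,\alpha_3)$ and $\tau\in S_3$, $R^{\tau}=(\alpha_{\tau^{-1}1},\alpha_{\tau^{-1}2},\alpha_{\tau^{-1}3})$. For $\sigma\in S_3$ the $\sigma$-parastrophe $A^\sigma$ of a quasigroup operation $A$ is the quasigroup operation determined by: $A(x_1,x_2)=x_3$ if and only if $A^{\sigma}(x_{\sigma^{-1}1},x_{\sigma^{-1}2})=x_{\sigma^{-1}3}$. For $\sigma\in S_3$ and a triple $R=(\alpha_1,\alpha_2,\alpha_3)$ of permutations of $Q$, the isostrophic image $A(\sigma,R)=(A^\sigma)R$ is the operation $B(x_1,x_2)=\alpha_3^{-1}\bigl(A^\sigma(\alpha_1x_1,\alpha_2x_2)\bigr)$. Pairs $(\sigma,R)$ are multiplied by $(\sigma,R)(\tau,S)=(\sigma\tau,R^{\tau}S)$,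 with inverses $(\sigma,R)^{-1}=(\sigma^{-1},(R^{-1})^{\sigma^{-1}})$. An autostrophism of $(Q,A)$ is a pair $(\sigma,R)$ with $A(\sigma,R)=A$. For $\sigma\in S_3$ and a quasigroup $(Q,\ast)$, the left (respectively right, middle) $\sigma$-A-nucleus ${}^{\sigma}N_l^{\ast}$ (respectively ${}^{\sigma}N_r^{\ast}$, ${}^{\sigma}N_m^{\ast}$) is the set of all autostrophisms of $(Q,\ast)$ of the form $(\sigma,(\alpha,\varepsilon,\gamma))$ (respectively $(\sigma,(\varepsilon,\beta,\gamma))$, $(\sigma,(\alpha,\beta,\varepsilon))$), with $\alpha,\beta,\gamma$ permutations of $Q$. These sets may be empty. For $v\in\{l,r,m\}$ and $i\in\{1,2,3\}$, ${}^{\sigma}_{i}N_v^{\ast}$ denotes the set of all $i$-th components $\alpha_i$ of elements $(\sigma,(\alpha_1,\alpha_2,\alpha_3))$ of ${}^{\sigma}N_v^{\ast}$. The same notation with $\circ$ in place of $\ast$ refers to $(Q,\circ)$. For a set $X$ of pairs and a pair $\theta$, $\theta^{-1}X\theta=\{\theta^{-1}x\theta: x\in X\}$. *)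

theory Defs
  imports "HOL-Combinatorics.Permutations"
begin

text \<open>
  A quasigroup is given by a carrier set \<open>Q\<close> and a curried operation; values of the operation outside
  \<open>Q\<close> are irrelevant. Permutations of \<open>Q\<close> are functions \<open>\<alpha>\<close> with \<open>\<alpha> permutes Q\<close> (so they are the
  identity outside \<open>Q\<close>, and equality of functions is equality of permutations); elements of \<open>S\<^sub>3\<close> are
  functions \<open>\<sigma>\<close> with \<open>\<sigma> permutes {1, 2, 3}\<close>.
\<close>

definition quasigroup :: "'a set \<Rightarrow> ('a \<Rightarrow> 'a \<Rightarrow> 'a) \<Rightarrow> bool" where
  "quasigroup Q A \<longleftrightarrow>
     (\<forall>x\<in>Q. \<forall>y\<in>Q. A x y \<in> Q) \<and>
     (\<forall>a\<in>Q. \<forall>b\<in>Q. (\<exists>!x. x \<in> Q \<and> A x a = b) \<and> (\<exists>!y. y \<in> Q \<and> A a y = b))"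

type_synonym 'a triple = "'a \<times> 'a \<times> 'a"

text \<open>Indices run through 1, 2, 3; the value at any other index is immaterial.\<close>

definition component :: "'a triple \<Rightarrow> nat \<Rightarrow> 'a" where
  "component R i = (case R of (a, b, c) \<Rightarrow> if i = 1 then a else if i = 2 then b else c)"

text \<open>Products in \<open>S\<^sub>3\<close> are computed from left to right.\<close>

definition s3_mult :: "(nat \<Rightarrow> nat) \<Rightarrow> (nat \<Rightarrow> nat) \<Rightarrow> nat \<Rightarrow> nat" where
  "s3_mult \<sigma> \<tau> = (\<lambda>i. \<tau> (\<sigma> i))"

definition triple_mult :: "('a \<Rightarrow> 'a) triple \<Rightarrow> ('a \<Rightarrow> 'a) triple \<Rightarrow> ('a \<Rightarrow> 'a) triple" where
  "triple_mult R S =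
     (component R 1 \<circ> component S 1, component R 2 \<circ> component S 2, component R 3 \<circ> component S 3)"

definition triple_inv :: "('a \<Rightarrow> 'a) triple \<Rightarrow> ('a \<Rightarrow> 'a) triple" where
  "triple_inv R = (inv (component R 1), inv (component R 2), inv (component R 3))"

text \<open>The action \<open>R\<^sup>\<tau>\<close> of \<open>S\<^sub>3\<close> on triples.\<close>

definition triple_act :: "'a triple \<Rightarrow> (nat \<Rightarrow> nat) \<Rightarrow> 'a triple" where
  "triple_act R \<tau> =
     (component R (inv \<tau> 1), component R (inv \<tau> 2), component R (inv \<tau> 3))"

text \<open>
  The parastrophe \<open>A\<^sup>\<sigma>\<close>: its graph is the image of the graph of \<open>A\<close> under the action of \<open>\<sigma>\<close> on
  triples; see \<open>parastrophe_iff\<close> below for the usual characterization.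
\<close>

definition parastrophe ::
  "'a set \<Rightarrow> ('a \<Rightarrow> 'a \<Rightarrow> 'a) \<Rightarrow> (nat \<Rightarrow> nat) \<Rightarrow> 'a \<Rightarrow> 'a \<Rightarrow> 'a" where
  "parastrophe Q A \<sigma> y\<^sub>1 y\<^sub>2 =
     (THE y\<^sub>3. \<exists>x\<^sub>1\<in>Q. \<exists>x\<^sub>2\<in>Q. \<exists>x\<^sub>3\<in>Q.
        A x\<^sub>1 x\<^sub>2 = x\<^sub>3 \<and> (y\<^sub>1, y\<^sub>2, y\<^sub>3) = triple_act (x\<^sub>1, x\<^sub>2, x\<^sub>3) \<sigma>)"

type_synonym 'a isostrophism = "(nat \<Rightarrow> nat) \<times> ('a \<Rightarrow> 'a) triple"

definition isostrophic_image ::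
  "'a set \<Rightarrow> ('a \<Rightarrow> 'a \<Rightarrow> 'a) \<Rightarrow> 'a isostrophism \<Rightarrow> 'a \<Rightarrow> 'a \<Rightarrow> 'a" where
  "isostrophic_image Q A \<theta> x\<^sub>1 x\<^sub>2 =
     (case \<theta> of (\<sigma>, \<alpha>\<^sub>1, \<alpha>\<^sub>2, \<alpha>\<^sub>3) \<Rightarrow> inv \<alpha>\<^sub>3 (parastrophe Q A \<sigma> (\<alpha>\<^sub>1 x\<^sub>1) (\<alpha>\<^sub>2 x\<^sub>2)))"

definition isostrophism_mult :: "'a isostrophism \<Rightarrow> 'a isostrophism \<Rightarrow> 'a isostrophism" where
  "isostrophism_mult \<theta> \<eta> =
     (case (\<theta>, \<eta>) of ((\<sigma>, R), (\<tau>, S)) \<Rightarrow> (s3_mult \<sigma> \<tau>, triple_mult (triple_act R \<tau>) S))"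

definition isostrophism_inv :: "'a isostrophism \<Rightarrow> 'a isostrophism" where
  "isostrophism_inv \<theta> = (case \<theta> of (\<sigma>, R) \<Rightarrow> (inv \<sigma>, triple_act (triple_inv R) (inv \<sigma>)))"

definition autostrophism :: "'a set \<Rightarrow> ('a \<Rightarrow> 'a \<Rightarrow> 'a) \<Rightarrow> 'a isostrophism \<Rightarrow> bool" where
  "autostrophism Q A \<theta> \<longleftrightarrow>
     (case \<theta> of (\<sigma>, \<alpha>\<^sub>1, \<alpha>\<^sub>2, \<alpha>\<^sub>3) \<Rightarrow>
        \<sigma> permutes {1, 2, 3} \<and> \<alpha>\<^sub>1 permutes Q \<and> \<alpha>\<^sub>2 permutes Q \<and> \<alpha>\<^sub>3 permutes Q) \<and>
     (\<forall>x\<in>Q. \<forall>y\<in>Q. isostrophic_image Q A \<theta> x y = A x y)"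

datatype side = Lft | Rgt | Mid

fun A_nucleus ::
  "side \<Rightarrow> 'a set \<Rightarrow> ('a \<Rightarrow> 'a \<Rightarrow> 'a) \<Rightarrow> (nat \<Rightarrow> nat) \<Rightarrow> 'a isostrophism set" where
  "A_nucleus Lft Q A \<sigma> = {(\<sigma>, (\<alpha>, id, \<gamma>)) |\<alpha> \<gamma>. autostrophism Q A (\<sigma>, (\<alpha>, id, \<gamma>))}"
| "A_nucleus Rgt Q A \<sigma> = {(\<sigma>, (id, \<beta>, \<gamma>)) |\<beta> \<gamma>. autostrophism Q A (\<sigma>, (id, \<beta>, \<gamma>))}"
| "A_nucleus Mid Q A \<sigma> = {(\<sigma>, (\<alpha>, \<beta>, id)) |\<alpha> \<beta>. autostrophism Q A (\<sigma>, (\<alpha>, \<beta>, id))}"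

definition A_nucleus_component ::
  "nat \<Rightarrow> side \<Rightarrow> 'a set \<Rightarrow> ('a \<Rightarrow> 'a \<Rightarrow> 'a) \<Rightarrow> (nat \<Rightarrow> nat) \<Rightarrow> ('a \<Rightarrow> 'a) set" where
  "A_nucleus_component i v Q A \<sigma> = (\<lambda>(\<rho>, R). component R i) ` A_nucleus v Q A \<sigma>"

definition conjugate_set :: "'a isostrophism set \<Rightarrow> 'a isostrophism \<Rightarrow> 'a isostrophism set" where
  "conjugate_set X \<theta> =
     (\<lambda>x. isostrophism_mult (isostrophism_mult (isostrophism_inv \<theta>) x) \<theta>) ` X"

text \<open>The kind of nucleus whose triples have the identity in position \<open>j\<close>, for \<open>j\<close> in 1, 2, 3.\<close>

definition side_of :: "nat \<Rightarrow> side" where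
  "side_of j = (if j = 1 then Rgt else if j = 2 then Lft else Mid)"

lemma component_simps [simp]:
  "component (a, b, c) 1 = a" "component (a, b, c) (Suc 0) = a"
  "component (a, b, c) 2 = b" "component (a, b, c) 3 = c"
  by (simp_all add: component_def)

lemma s3_inv_cases:
  assumes "\<sigma> permutes {1, 2, 3::nat}"
  shows "(inv \<sigma> 1, inv \<sigma> 2, inv \<sigma> 3) \<in>
    {(1, 2, 3), (1, 3, 2), (2, 1, 3), (2, 3, 1), (3, 1, 2), (3, 2, 1)}"
proof -
  have p: "inv \<sigma> permutes {1, 2, 3}"
    using assms by (rule permutes_inv)
  have "inv \<sigma> 1 \<in> {1, 2, 3}" "inv \<sigma> 2 \<in> {1, 2, 3}" "inv \<sigma> 3 \<in> {1, 2, 3}"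
    using permutes_in_image[OF p] by blast+
  moreover have "inv \<sigma> 1 \<noteq> inv \<sigma> 2" "inv \<sigma> 1 \<noteq> inv \<sigma> 3" "inv \<sigma> 2 \<noteq> inv \<sigma> 3"
    using inj_eq[OF permutes_inj[OF p]] by simp_all
  moreover have "(a, b, c) \<in> {(1, 2, 3), (1, 3, 2), (2, 1, 3), (2, 3, 1), (3, 1, 2), (3, 2, 1)}"
    if "a \<in> {1, 2, 3}" "b \<in> {1, 2, 3}" "c \<in> {1, 2, 3}" "a \<noteq> b" "a \<noteq> c" "b \<noteq> c"
    for a b c :: nat
    using that by (elim insertE emptyE) simp_all
  ultimately show ?thesis by blast
qed

lemma parastrophe_ex1:
  assumes "quasigroup Q A" "\<sigma> permutes {1, 2, 3}" "y\<^sub>1 \<in> Q" "y\<^sub>2 \<in> Q"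
  shows "\<exists>!y\<^sub>3. \<exists>x\<^sub>1\<in>Q. \<exists>x\<^sub>2\<in>Q. \<exists>x\<^sub>3\<in>Q.
        A x\<^sub>1 x\<^sub>2 = x\<^sub>3 \<and> (y\<^sub>1, y\<^sub>2, y\<^sub>3) = triple_act (x\<^sub>1, x\<^sub>2, x\<^sub>3) \<sigma>"
proof -
  have cl: "\<And>x y. x \<in> Q \<Longrightarrow> y \<in> Q \<Longrightarrow> A x y \<in> Q"
    and l: "\<And>a b. a \<in> Q \<Longrightarrow> b \<in> Q \<Longrightarrow> \<exists>!x. x \<in> Q \<and> A x a = b"
    and r: "\<And>a b. a \<in> Q \<Longrightarrow> b \<in> Q \<Longrightarrow> \<exists>!y. y \<in> Q \<and> A a y = b"
    using assms(1) unfolding quasigroup_def by blast+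
  have eq: "(\<exists>x\<^sub>1\<in>Q. \<exists>x\<^sub>2\<in>Q. \<exists>x\<^sub>3\<in>Q.
        A x\<^sub>1 x\<^sub>2 = x\<^sub>3 \<and> (y\<^sub>1, y\<^sub>2, z) = triple_act (x\<^sub>1, x\<^sub>2, x\<^sub>3) \<sigma>) \<longleftrightarrow>
      z \<in> Q \<and> (case (inv \<sigma> 1, inv \<sigma> 2) of (i, j) \<Rightarrow>
        if (i, j) = (1, 2) then A y\<^sub>1 y\<^sub>2 = z else if (i, j) = (2, 1) then A y\<^sub>2 y\<^sub>1 = z
        else if (i, j) = (1, 3) then A y\<^sub>1 z = y\<^sub>2 else if (i, j) = (3, 1) then A y\<^sub>2 z = y\<^sub>1
        else if (i, j) = (2, 3) then A z y\<^sub>1 = y\<^sub>2 else A z y\<^sub>2 = y\<^sub>1)" for z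
    using s3_inv_cases[OF assms(2)] assms(3,4) cl unfolding triple_act_def
    by (elim insertE emptyE) auto
  have m: "\<exists>!z. z \<in> Q \<and> A a b = z" if "a \<in> Q" "b \<in> Q" for a b
    using cl[OF that] by blast
  show ?thesis
    unfolding eq using s3_inv_cases[OF assms(2)]
    by (elim insertE emptyE) (simp_all add: m l r assms(3,4) del: ex1_eq)
qed

lemma parastrophe_iff:
  assumes "quasigroup Q A" "\<sigma> permutes {1, 2, 3}" "x\<^sub>1 \<in> Q" "x\<^sub>2 \<in> Q" "x\<^sub>3 \<in> Q"
  shows "A x\<^sub>1 x\<^sub>2 = x\<^sub>3 \<longleftrightarrow>
    parastrophe Q A \<sigma> (component (x\<^sub>1, x\<^sub>2, x\<^sub>3) (inv \<sigma> 1)) (component (x\<^sub>1, x\<^sub>2, x\<^sub>3) (inv \<sigma> 2))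
      = component (x\<^sub>1, x\<^sub>2, x\<^sub>3) (inv \<sigma> 3)"
proof -
  let ?y = "\<lambda>i. component (x\<^sub>1, x\<^sub>2, x\<^sub>3) (inv \<sigma> i)"
  let ?P = "\<lambda>z. \<exists>u\<^sub>1\<in>Q. \<exists>u\<^sub>2\<in>Q. \<exists>u\<^sub>3\<in>Q.
        A u\<^sub>1 u\<^sub>2 = u\<^sub>3 \<and> (?y 1, ?y 2, z) = triple_act (u\<^sub>1, u\<^sub>2, u\<^sub>3) \<sigma>"
  have "?y 1 \<in> Q" "?y 2 \<in> Q"
    using assms(3-5) by (auto simp: component_def)
  then have ex1: "\<exists>!z. ?P z"
    by (rule parastrophe_ex1[OF assms(1,2)])
  have the: "P w \<longleftrightarrow> (THE z. P z) = w" if "\<exists>!z. P z" for P and w :: 'a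
    using theI'[OF that] the1_equality[OF that] by blast
  have "A x\<^sub>1 x\<^sub>2 = x\<^sub>3 \<longleftrightarrow> ?P (?y 3)"
    using s3_inv_cases[OF assms(2)] assms(3-5) unfolding triple_act_def
    by (elim insertE emptyE) auto
  also have "\<dots> \<longleftrightarrow> (THE z. ?P z) = ?y 3"
    by (rule the[OF ex1])
  finally show ?thesis unfolding parastrophe_def .
qed

end

theory Submission
  imports Defs
begin

text \<open>
  A quasigroup operation is determined by its graph, a ternary relation on \<open>Q\<close>, and the quasigroup
  axioms treat the three coordinates of the graph alike: any two of them determine the third
  (lemma \<open>quasigroup_iff_graph\<close>). In this picture passing to the \<open>\<tau>\<close>-parastrophe is just a
  permutation of the coordinates (\<open>on_graph_parastrophe\<close>), so parastrophes are quasigroups, and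
  \<open>(\<sigma>, R)\<close> is an autostrophism exactly if the graph is preserved when \<open>R\<close> is applied
  coordinatewise and the coordinates are then permuted by \<open>\<sigma>\<close> (\<open>autostrophism_iff_graph\<close>).

  Renaming the coordinates by \<open>\<tau>\<close> therefore turns the autostrophisms \<open>(\<tau>\<sigma>\<tau>\<^sup>-\<^sup>1, R)\<close> of \<open>(Q, *)\<close>
  into the autostrophisms \<open>(\<sigma>, R\<^sup>\<tau>)\<close> of its \<open>\<tau>\<close>-parastrophe (\<open>autostrophism_parastrophe_iff\<close>), and
  this renaming is conjugation by \<open>\<theta> = (\<tau>, (\<epsilon>, \<epsilon>, \<epsilon>))\<close>. The \<open>i\<close>-th entry of \<open>R\<^sup>\<tau>\<close> is the
  \<open>\<tau>\<^sup>-\<^sup>1 i\<close>-th entry of \<open>R\<close>. As the nuclei are cut out by the position of an identity entry, a nucleus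
  of the parastrophe with identities in position \<open>j\<close> comes from the nucleus of \<open>(Q, *)\<close> with
  identities in position \<open>\<tau>\<^sup>-\<^sup>1 j\<close>, and the component sets are matched in the same way. The claims are
  the cases \<open>j = 2, 1, 3\<close> of this one statement.
\<close>

section \<open>Graphs of quasigroup operations\<close>

text \<open>
  Points of \<open>Q\<^sup>3\<close> are taken as functions on the index set, so that permuting coordinates is composition
  of functions.
\<close>

definition on_graph :: "('a \<Rightarrow> 'a \<Rightarrow> 'a) \<Rightarrow> (nat \<Rightarrow> 'a) \<Rightarrow> bool" where
  "on_graph A x \<longleftrightarrow> A (x 1) (x 2) = x 3"

definition points :: "'a set \<Rightarrow> (nat \<Rightarrow> 'a) set" where
  "points Q = {x. \<forall>i\<in>{1, 2, 3}. x i \<in> Q}"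

lemma component_of_function:
  "i \<in> {1, 2, 3} \<Longrightarrow> component (f 1, f 2, f 3) i = f i"
  by (auto simp: component_def)

lemma component_triple_act:
  "i \<in> {1, 2, 3} \<Longrightarrow> component (triple_act R \<tau>) i = component R (inv \<tau> i)"
  by (auto simp: triple_act_def component_def)

lemma triple_eq_iff_component:
  "R = S \<longleftrightarrow> (\<forall>i\<in>{1, 2, 3}. component R i = component S i)"
  by (cases R; cases S) auto

lemma permutes_index: "\<sigma> permutes {1, 2, 3} \<Longrightarrow> i \<in> {1, 2, 3} \<Longrightarrow> \<sigma> i \<in> {1, 2, 3::nat}"
  using permutes_in_image[of \<sigma> "{1, 2, 3}" i] by blast

lemma points_comp:
  "\<sigma> permutes {1, 2, 3} \<Longrightarrow> x \<in> points Q \<Longrightarrow> x \<circ> \<sigma> \<in> points Q"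
  using permutes_index[of \<sigma> 1] permutes_index[of \<sigma> 2] permutes_index[of \<sigma> 3]
  unfolding points_def by auto

text \<open>
  The form of the quasigroup axioms that is symmetric in the three coordinates; the case
  \<open>j = 3\<close> is closure of \<open>Q\<close> under the operation.
\<close>

lemma quasigroup_iff_graph:
  "quasigroup Q A \<longleftrightarrow>
    (\<forall>j\<in>{1, 2, 3}. \<forall>x\<in>points Q. \<exists>!v. v \<in> Q \<and> on_graph A (x(j := v)))"
  (is "_ \<longleftrightarrow> ?G")
proof
  assume "quasigroup Q A"
  then have cl: "A a b \<in> Q"
    and l: "\<exists>!v. v \<in> Q \<and> A v a = b" and r: "\<exists>!v. v \<in> Q \<and> A a v = b"
    if "a \<in> Q" "b \<in> Q" for a b
    using that unfolding quasigroup_def by blast+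
  show ?G
  proof (intro ballI)
    fix j x assume j: "j \<in> {1, 2, 3::nat}" and x: "x \<in> points Q"
    have Q: "x 1 \<in> Q" "x 2 \<in> Q" "x 3 \<in> Q"
      using x by (simp_all add: points_def)
    consider "j = 1" | "j = 2" | "j = 3"
      using j by blast
    then show "\<exists>!v. v \<in> Q \<and> on_graph A (x(j := v))"
    proof cases
      case 1
      then show ?thesis
        using l[OF Q(2,3)] by (simp add: on_graph_def)
    next
      case 2
      then show ?thesis
        using r[OF Q(1,3)] by (simp add: on_graph_def)
    next
      case 3
      have "\<exists>!v. v \<in> Q \<and> A (x 1) (x 2) = v"
        using cl[OF Q(1,2)] by blast
      then show ?thesis
        using 3 by (simp add: on_graph_def)
    qed
  qed
next
  assume G: ?G
  have *: "\<exists>!v. v \<in> Q \<and> on_graph A ((\<lambda>i. component (a, b, c) i)(j := v))"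
    if "j \<in> {1, 2, 3}" "a \<in> Q" "b \<in> Q" "c \<in> Q" for a b c j
    using that by (intro G[rule_format]) (auto simp: points_def)
  have "A a b \<in> Q" if "a \<in> Q" "b \<in> Q" for a b
    using ex1_implies_ex[OF *[of 3 a b b]] that by (auto simp: on_graph_def)
  moreover have "\<exists>!x. x \<in> Q \<and> A x a = b" if "a \<in> Q" "b \<in> Q" for a b
    using *[of 1 a a b] that by (simp add: on_graph_def)
  moreover have "\<exists>!y. y \<in> Q \<and> A a y = b" if "a \<in> Q" "b \<in> Q" for a b
    using *[of 2 a a b] that by (simp add: on_graph_def)
  ultimately show "quasigroup Q A"
    unfolding quasigroup_def by (intro conjI ballI)
qed

text \<open>
  The point \<open>x \<circ> \<sigma>\<close> has \<open>x i\<close> in position \<open>\<sigma>\<^sup>-\<^sup>1 i\<close>. So the operation \<open>A\<close> relates the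
  coordinates of \<open>x \<circ> \<sigma>\<close> precisely when its \<open>\<sigma>\<close>-parastrophe relates those of \<open>x\<close>.
\<close>

lemma on_graph_parastrophe:
  assumes "quasigroup Q A" "\<sigma> permutes {1, 2, 3}" "x \<in> points Q"
  shows "on_graph (parastrophe Q A \<sigma>) x \<longleftrightarrow> on_graph A (x \<circ> \<sigma>)"
proof -
  have Q: "x (\<sigma> 1) \<in> Q" "x (\<sigma> 2) \<in> Q" "x (\<sigma> 3) \<in> Q"
    using points_comp[OF assms(2,3)] by (auto simp: points_def)
  have c: "component (x (\<sigma> 1), x (\<sigma> 2), x (\<sigma> 3)) (inv \<sigma> i) = x i" if "i \<in> {1, 2, 3}" for i
    using component_of_function[OF permutes_index[OF permutes_inv[OF assms(2)] that], of "x \<circ> \<sigma>"]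
      permutes_inverses(1)[OF assms(2)] by simp
  show ?thesis
    using parastrophe_iff[OF assms(1,2) Q] c[of 1] c[of 2] c[of 3] by (simp add: on_graph_def)
qed

lemma quasigroup_parastrophe:
  assumes A: "quasigroup Q A" and s: "\<sigma> permutes {1, 2, 3}"
  shows "quasigroup Q (parastrophe Q A \<sigma>)"
  unfolding quasigroup_iff_graph
proof (intro ballI)
  fix j x assume j: "j \<in> {1, 2, 3::nat}" and x: "x \<in> points Q"
  \<comment> \<open>Solving for coordinate \<open>j\<close> of the parastrophe is solving for coordinate \<open>\<sigma>\<^sup>-\<^sup>1 j\<close> of \<open>A\<close>.\<close>
  have upd: "x(j := v) \<circ> \<sigma> = (x \<circ> \<sigma>)(inv \<sigma> j := v)" for v
    using permutes_inverses[OF s] by (auto simp: fun_eq_iff)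
  have "(v \<in> Q \<and> on_graph (parastrophe Q A \<sigma>) (x(j := v))) \<longleftrightarrow>
      (v \<in> Q \<and> on_graph A ((x \<circ> \<sigma>)(inv \<sigma> j := v)))" for v
    using on_graph_parastrophe[OF A s, of "x(j := v)"] x unfolding upd
    by (auto simp: points_def)
  moreover have "\<exists>!v. v \<in> Q \<and> on_graph A ((x \<circ> \<sigma>)(inv \<sigma> j := v))"
    using A[unfolded quasigroup_iff_graph] permutes_index[OF permutes_inv[OF s] j]
      points_comp[OF s x] by blast
  ultimately show "\<exists>!v. v \<in> Q \<and> on_graph (parastrophe Q A \<sigma>) (x(j := v))"
    by simp
qed

section \<open>Autostrophisms of a parastrophe\<close>

text \<open>
  The equation \<open>\<alpha>\<^sub>3\<^sup>-\<^sup>1 (A\<^sup>\<sigma> (\<alpha>\<^sub>1 x\<^sub>1, \<alpha>\<^sub>2 x\<^sub>2)) = x\<^sub>3\<close> says that the point \<open>(\<alpha>\<^sub>i x\<^sub>i)\<close> lies on the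
  graph of \<open>A\<^sup>\<sigma>\<close>, which reindexing by \<open>\<sigma>\<close> turns into a condition on the graph of \<open>A\<close>. In this form
  the inverse and the special role of the third coordinate are gone, and reindexing becomes easy.
\<close>

lemma autostrophism_iff_graph:
  assumes A: "quasigroup Q A"
  shows "autostrophism Q A (\<sigma>, R) \<longleftrightarrow>
    \<sigma> permutes {1, 2, 3} \<and> (\<forall>i\<in>{1, 2, 3}. component R i permutes Q) \<and>
    (\<forall>x\<in>points Q. on_graph A x \<longleftrightarrow> on_graph A ((\<lambda>i. component R i (x i)) \<circ> \<sigma>))"
proof -
  obtain a b c where R: "R = (a, b, c)"
    by (cases R)
  have main: "(\<forall>x\<in>Q. \<forall>y\<in>Q. isostrophic_image Q A (\<sigma>, R) x y = A x y) \<longleftrightarrow>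
      (\<forall>x\<in>points Q. on_graph A x \<longleftrightarrow> on_graph A ((\<lambda>i. component R i (x i)) \<circ> \<sigma>))"
    if s: "\<sigma> permutes {1, 2, 3}" and p: "a permutes Q" "b permutes Q" "c permutes Q"
  proof -
    have graph: "on_graph A ((\<lambda>i. component R i (x i)) \<circ> \<sigma>) \<longleftrightarrow>
        isostrophic_image Q A (\<sigma>, R) (x 1) (x 2) = x 3" if "x \<in> points Q" for x
    proof -
      have "(\<lambda>i. component R i (x i)) \<in> points Q"
        using that p by (auto simp: points_def R permutes_in_image)
      from on_graph_parastrophe[OF A s this]
      have "on_graph A ((\<lambda>i. component R i (x i)) \<circ> \<sigma>) \<longleftrightarrow>
          parastrophe Q A \<sigma> (a (x 1)) (b (x 2)) = c (x 3)"
        by (simp add: on_graph_def R)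
      also have "\<dots> \<longleftrightarrow> inv c (parastrophe Q A \<sigma> (a (x 1)) (b (x 2))) = x 3"
        using permutes_inverses[OF p(3)] by metis
      finally show ?thesis
        by (simp add: isostrophic_image_def R)
    qed
    show ?thesis
    proof
      assume "\<forall>x\<in>Q. \<forall>y\<in>Q. isostrophic_image Q A (\<sigma>, R) x y = A x y"
      then show "\<forall>x\<in>points Q.
          on_graph A x \<longleftrightarrow> on_graph A ((\<lambda>i. component R i (x i)) \<circ> \<sigma>)"
        using graph by (simp add: on_graph_def points_def)
    next
      assume pres: "\<forall>x\<in>points Q.
          on_graph A x \<longleftrightarrow> on_graph A ((\<lambda>i. component R i (x i)) \<circ> \<sigma>)"
      show "\<forall>x\<in>Q. \<forall>y\<in>Q. isostrophic_image Q A (\<sigma>, R) x y = A x y"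
      proof (intro ballI)
        fix x y assume xy: "x \<in> Q" "y \<in> Q"
        \<comment> \<open>Testing preservation on the point of the graph above \<open>(x, y)\<close> suffices.\<close>
        let ?z = "\<lambda>i. component (x, y, A x y) i"
        have z: "?z \<in> points Q"
          using xy A by (simp add: points_def quasigroup_def)
        show "isostrophic_image Q A (\<sigma>, R) x y = A x y"
          using pres[rule_format, OF z] graph[OF z] by (simp add: on_graph_def)
      qed
    qed
  qed
  then show ?thesis
    unfolding autostrophism_def by (auto simp: R)
qed

text \<open>
  Both sides say that the graph of \<open>A\<close> is preserved by one and the same map of \<open>Q\<^sup>3\<close>, once the
  points of \<open>Q\<^sup>3\<close> are reindexed along \<open>\<tau>\<close>: writing \<open>y = x \<circ> \<tau>\<close>, the image of \<open>x\<close> under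
  \<open>(\<sigma>, R\<^sup>\<tau>)\<close> becomes the image of \<open>y\<close> under \<open>(\<tau>\<sigma>\<tau>\<^sup>-\<^sup>1, R)\<close>. Values of an operation outside \<open>Q\<close>
  are irrelevant, which is why \<open>circ\<close> is compared with the parastrophe on \<open>Q\<close>.
\<close>

lemma autostrophism_parastrophe_iff:
  assumes A: "quasigroup Q A" and t: "\<tau> permutes {1, 2, 3}" and s: "\<sigma> permutes {1, 2, 3}"
    and circ: "\<forall>x\<in>Q. \<forall>y\<in>Q. circ x y = parastrophe Q A \<tau> x y"
  shows "autostrophism Q circ (\<sigma>, triple_act R \<tau>) \<longleftrightarrow>
    autostrophism Q A (s3_mult (s3_mult \<tau> \<sigma>) (inv \<tau>), R)"
proof -
  let ?\<rho> = "s3_mult (s3_mult \<tau> \<sigma>) (inv \<tau>)"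
  let ?S = "triple_act R \<tau>"
  have ti: "inv \<tau> permutes {1, 2, 3}"
    by (rule permutes_inv[OF t])
  have "?\<rho> = inv \<tau> \<circ> (\<sigma> \<circ> \<tau>)"
    by (auto simp: s3_mult_def)
  then have rho: "?\<rho> permutes {1, 2, 3}"
    using permutes_compose[OF permutes_compose[OF t s] ti] by simp
  have circ_graph: "on_graph circ x \<longleftrightarrow> on_graph A (x \<circ> \<tau>)" if x: "x \<in> points Q" for x
  proof -
    have "on_graph circ x \<longleftrightarrow> on_graph (parastrophe Q A \<tau>) x"
      using x circ by (simp add: on_graph_def points_def)
    then show ?thesis
      using on_graph_parastrophe[OF A t x] by simp
  qed
  have "quasigroup Q circ"
    using quasigroup_parastrophe[OF A t] circ unfolding quasigroup_def
    by (simp add: circ cong: conj_cong)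
  note circ_auto = autostrophism_iff_graph[OF this]
  have perm: "(\<forall>i\<in>{1, 2, 3}. component ?S i permutes Q) \<longleftrightarrow>
      (\<forall>i\<in>{1, 2, 3}. component R i permutes Q)"
  proof -
    have "(\<forall>i\<in>{1, 2, 3}. component ?S i permutes Q) \<longleftrightarrow>
        (\<forall>i\<in>inv \<tau> ` {1, 2, 3}. component R i permutes Q)"
      using component_triple_act[of _ R \<tau>] by simp
    then show ?thesis
      unfolding permutes_image[OF ti] .
  qed
  have graph: "(\<forall>x\<in>points Q. on_graph circ x \<longleftrightarrow> on_graph circ ((\<lambda>i. component ?S i (x i)) \<circ> \<sigma>)) \<longleftrightarrow>
      (\<forall>y\<in>points Q. on_graph A y \<longleftrightarrow> on_graph A ((\<lambda>i. component R i (y i)) \<circ> ?\<rho>))"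
    if p: "\<forall>i\<in>{1, 2, 3}. component ?S i permutes Q"
  proof -
    have step: "(on_graph circ x \<longleftrightarrow> on_graph circ ((\<lambda>i. component ?S i (x i)) \<circ> \<sigma>)) \<longleftrightarrow>
        (on_graph A (x \<circ> \<tau>) \<longleftrightarrow> on_graph A ((\<lambda>i. component R i ((x \<circ> \<tau>) i)) \<circ> ?\<rho>))"
      if x: "x \<in> points Q" for x
    proof -
      have "(\<lambda>i. component ?S i (x i)) \<in> points Q"
        using x p by (simp add: points_def permutes_in_image)
      then have "on_graph circ ((\<lambda>i. component ?S i (x i)) \<circ> \<sigma>) \<longleftrightarrow>
          on_graph A ((\<lambda>i. component ?S i (x i)) \<circ> \<sigma> \<circ> \<tau>)"
        by (intro circ_graph points_comp[OF s])
      also have "\<dots> \<longleftrightarrow> on_graph A ((\<lambda>i. component R i ((x \<circ> \<tau>) i)) \<circ> ?\<rho>)"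
      proof -
        have "((\<lambda>i. component ?S i (x i)) \<circ> \<sigma> \<circ> \<tau>) i = ((\<lambda>i. component R i ((x \<circ> \<tau>) i)) \<circ> ?\<rho>) i"
          if "i \<in> {1, 2, 3}" for i
          using component_triple_act[OF permutes_index[OF s permutes_index[OF t that]], of R \<tau>]
            permutes_inverses(1)[OF t] by (simp add: s3_mult_def)
        then show ?thesis
          by (simp add: on_graph_def)
      qed
      finally show ?thesis
        using circ_graph[OF x] by simp
    qed
    \<comment> \<open>Every point has the form \<open>x \<circ> \<tau>\<close>, so both quantifiers range over the same points.\<close>
    have surj: "points Q = (\<lambda>x. x \<circ> \<tau>) ` points Q"
    proof (intro equalityI subsetI)
      fix y assume y: "y \<in> points Q"
      have "y = (y \<circ> inv \<tau>) \<circ> \<tau>"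
        using permutes_inverses(2)[OF t] by (auto simp: fun_eq_iff)
      then show "y \<in> (\<lambda>x. x \<circ> \<tau>) ` points Q"
        using points_comp[OF ti y] by (rule image_eqI)
    qed (use points_comp[OF t] in auto)
    show ?thesis
      using step by (subst (2) surj) simp
  qed
  show ?thesis
    unfolding circ_auto autostrophism_iff_graph[OF A] using perm graph s rho by blast
qed

section \<open>Nuclei of a parastrophe\<close>

text \<open>
  A description of the three kinds of nucleus that is uniform in the position \<open>j\<close> of the identity, so
  that permuting positions acts on it.
\<close>

lemma A_nucleus_side_of:
  "j \<in> {1, 2, 3} \<Longrightarrow>
    A_nucleus (side_of j) Q A \<sigma> = {(\<sigma>, R) |R. component R j = id \<and> autostrophism Q A (\<sigma>, R)}"
  by (auto simp: side_of_def)

lemma conjugate_by_parastrophy: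
  fixes R :: "('a \<Rightarrow> 'a) triple"
  assumes t: "\<tau> permutes {1, 2, 3}"
  shows "isostrophism_mult (isostrophism_mult (isostrophism_inv (\<tau>, (id, id, id)))
      (s3_mult (s3_mult \<tau> \<sigma>) (inv \<tau>), R)) (\<tau>, (id, id, id)) = (\<sigma>, triple_act R \<tau>)"
proof -
  let ?e = "(id, id, id) :: ('a \<Rightarrow> 'a) triple"
  have "s3_mult (s3_mult (inv \<tau>) (s3_mult (s3_mult \<tau> \<sigma>) (inv \<tau>))) \<tau> = \<sigma>"
    using permutes_inverses[OF t] by (simp add: s3_mult_def)
  moreover have "triple_act ?e \<pi> = ?e" for \<pi>
    by (simp add: triple_act_def component_def)
  moreover have "triple_inv ?e = ?e"
    by (simp add: triple_inv_def)
  moreover have "triple_mult ?e S = S" "triple_mult S ?e = S" for S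
    by (simp_all add: triple_mult_def triple_eq_iff_component)
  ultimately show ?thesis
    by (simp add: isostrophism_mult_def isostrophism_inv_def)
qed

lemma triple_act_surj:
  assumes "\<tau> permutes {1, 2, 3}"
  obtains R where "S = triple_act R \<tau>"
proof
  have "component (component S (\<tau> 1), component S (\<tau> 2), component S (\<tau> 3)) (inv \<tau> i) = component S i"
    if "i \<in> {1, 2, 3}" for i
    using component_of_function[OF permutes_index[OF permutes_inv[OF assms] that],
        of "component S \<circ> \<tau>"] permutes_inverses(1)[OF assms] by simp
  then show "S = triple_act (component S (\<tau> 1), component S (\<tau> 2), component S (\<tau> 3)) \<tau>"
    by (simp add: triple_eq_iff_component component_triple_act)
qed

text \<open>
  The autostrophisms correspond by \<open>autostrophism_parastrophe_iff\<close>, and \<open>R\<^sup>\<tau>\<close> has an identity in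
  position \<open>j\<close> exactly if \<open>R\<close> has one in position \<open>\<tau>\<^sup>-\<^sup>1 j\<close>. The action of \<open>\<tau>\<close> on triples is
  surjective, so every element of the nucleus on the left is reached.
\<close>

lemma A_nucleus_parastrophe:
  assumes A: "quasigroup Q A" and t: "\<tau> permutes {1, 2, 3}" and s: "\<sigma> permutes {1, 2, 3}"
    and circ: "\<forall>x\<in>Q. \<forall>y\<in>Q. circ x y = parastrophe Q A \<tau> x y"
    and j: "j \<in> {1, 2, 3}"
  shows "A_nucleus (side_of j) Q circ \<sigma> =
      (\<lambda>(_, R). (\<sigma>, triple_act R \<tau>)) ` A_nucleus (side_of (inv \<tau> j)) Q A (s3_mult (s3_mult \<tau> \<sigma>) (inv \<tau>))"
proof -
  let ?\<rho> = "s3_mult (s3_mult \<tau> \<sigma>) (inv \<tau>)"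
  have "inv \<tau> j \<in> {1, 2, 3}"
    by (rule permutes_index[OF permutes_inv[OF t] j])
  note nuc = A_nucleus_side_of[OF j] A_nucleus_side_of[OF this]
  have iff: "component (triple_act R \<tau>) j = id \<and> autostrophism Q circ (\<sigma>, triple_act R \<tau>) \<longleftrightarrow>
      component R (inv \<tau> j) = id \<and> autostrophism Q A (?\<rho>, R)" for R
    by (simp add: autostrophism_parastrophe_iff[OF A t s circ] component_triple_act[OF j])
  show ?thesis
    unfolding nuc
  proof (intro equalityI subsetI)
    fix x assume "x \<in> {(\<sigma>, S) |S. component S j = id \<and> autostrophism Q circ (\<sigma>, S)}"
    then obtain S where x: "x = (\<sigma>, S)" "component S j = id \<and> autostrophism Q circ (\<sigma>, S)"
      by blast
    obtain R where "S = triple_act R \<tau>"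
      using triple_act_surj[OF t] .
    then show "x \<in> (\<lambda>(_, R). (\<sigma>, triple_act R \<tau>)) `
        {(?\<rho>, R) |R. component R (inv \<tau> j) = id \<and> autostrophism Q A (?\<rho>, R)}"
      using x iff[of R] by (intro image_eqI[of _ _ "(?\<rho>, R)"]) (simp_all del: split_paired_Ex)
  next
    fix x assume "x \<in> (\<lambda>(_, R). (\<sigma>, triple_act R \<tau>)) `
        {(?\<rho>, R) |R. component R (inv \<tau> j) = id \<and> autostrophism Q A (?\<rho>, R)}"
    then show "x \<in> {(\<sigma>, S) |S. component S j = id \<and> autostrophism Q circ (\<sigma>, S)}"
      using iff by (auto simp del: split_paired_Ex split_paired_All)
  qed
qed

lemma A_nucleus_parastrophe_conjugate:
  assumes A: "quasigroup Q A" and t: "\<tau> permutes {1, 2, 3}" and s: "\<sigma> permutes {1, 2, 3}"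
    and circ: "\<forall>x\<in>Q. \<forall>y\<in>Q. circ x y = parastrophe Q A \<tau> x y"
    and j: "j \<in> {1, 2, 3}"
  shows "A_nucleus (side_of j) Q circ \<sigma> =
      conjugate_set (A_nucleus (side_of (inv \<tau> j)) Q A (s3_mult (s3_mult \<tau> \<sigma>) (inv \<tau>)))
        (\<tau>, (id, id, id))"
  unfolding A_nucleus_parastrophe[OF assms] conjugate_set_def
proof (rule image_cong[OF refl])
  fix x assume "x \<in> A_nucleus (side_of (inv \<tau> j)) Q A (s3_mult (s3_mult \<tau> \<sigma>) (inv \<tau>))"
  then obtain R where "x = (s3_mult (s3_mult \<tau> \<sigma>) (inv \<tau>), R)"
    using A_nucleus_side_of[OF permutes_index[OF permutes_inv[OF t] j]] by blast
  then show "(case x of (_, R) \<Rightarrow> (\<sigma>, triple_act R \<tau>)) =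
      isostrophism_mult (isostrophism_mult (isostrophism_inv (\<tau>, id, id, id)) x) (\<tau>, id, id, id)"
    by (simp add: conjugate_by_parastrophy[OF t])
qed

lemma A_nucleus_component_parastrophe:
  assumes "quasigroup Q A" "\<tau> permutes {1, 2, 3}" "\<sigma> permutes {1, 2, 3}"
    and "\<forall>x\<in>Q. \<forall>y\<in>Q. circ x y = parastrophe Q A \<tau> x y"
    and "j \<in> {1, 2, 3}" and i: "i \<in> {1, 2, 3}"
  shows "A_nucleus_component i (side_of j) Q circ \<sigma> =
      A_nucleus_component (inv \<tau> i) (side_of (inv \<tau> j)) Q A (s3_mult (s3_mult \<tau> \<sigma>) (inv \<tau>))"
  unfolding A_nucleus_component_def A_nucleus_parastrophe[OF assms(1-5)] image_image
  by (rule image_cong[OF refl]) (simp add: component_triple_act[OF i] split: prod.split)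

theorem theorem5:
  fixes Q :: "'a set" and star circ :: "'a \<Rightarrow> 'a \<Rightarrow> 'a" and \<tau> :: "nat \<Rightarrow> nat"
    and \<theta> :: "'a isostrophism"
  assumes star: "quasigroup Q star"
    and tau: "\<tau> permutes {1, 2, 3}"
    and circ: "\<And>x y. x \<in> Q \<Longrightarrow> y \<in> Q \<Longrightarrow> circ x y = parastrophe Q star \<tau> x y"
    and theta: "\<theta> = (\<tau>, (id, id, id))"
  shows "\<forall>\<sigma>. \<sigma> permutes {1, 2, 3} \<longrightarrow>
    (let \<rho> = s3_mult (s3_mult \<tau> \<sigma>) (inv \<tau>) in
      (let v = side_of (inv \<tau> 2) in
        A_nucleus Lft Q circ \<sigma> = conjugate_set (A_nucleus v Q star \<rho>) \<theta> \<and>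
        A_nucleus_component 1 Lft Q circ \<sigma> = A_nucleus_component (inv \<tau> 1) v Q star \<rho> \<and>
        A_nucleus_component 3 Lft Q circ \<sigma> = A_nucleus_component (inv \<tau> 3) v Q star \<rho>) \<and>
      (let v = side_of (inv \<tau> 1) in
        A_nucleus Rgt Q circ \<sigma> = conjugate_set (A_nucleus v Q star \<rho>) \<theta> \<and>
        A_nucleus_component 2 Rgt Q circ \<sigma> = A_nucleus_component (inv \<tau> 2) v Q star \<rho> \<and>
        A_nucleus_component 3 Rgt Q circ \<sigma> = A_nucleus_component (inv \<tau> 3) v Q star \<rho>) \<and>
      (let v = side_of (inv \<tau> 3) in
        A_nucleus Mid Q circ \<sigma> = conjugate_set (A_nucleus v Q star \<rho>) \<theta> \<and>
        A_nucleus_component 1 Mid Q circ \<sigma> = A_nucleus_component (inv \<tau> 1) v Q star \<rho> \<and>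
        A_nucleus_component 2 Mid Q circ \<sigma> = A_nucleus_component (inv \<tau> 2) v Q star \<rho>))"
proof (intro allI impI)
  fix \<sigma> :: "nat \<Rightarrow> nat" assume s: "\<sigma> permutes {1, 2, 3}"
  have side: "side_of 2 = Lft" "side_of 1 = Rgt" "side_of 3 = Mid"
    by (simp_all add: side_of_def)
  have circ': "\<forall>x\<in>Q. \<forall>y\<in>Q. circ x y = parastrophe Q star \<tau> x y"
    using circ by blast
  note conj = A_nucleus_parastrophe_conjugate[OF star tau s circ', folded theta]
  note comp = A_nucleus_component_parastrophe[OF star tau s circ']
  show "let \<rho> = s3_mult (s3_mult \<tau> \<sigma>) (inv \<tau>) in
      (let v = side_of (inv \<tau> 2) in
        A_nucleus Lft Q circ \<sigma> = conjugate_set (A_nucleus v Q star \<rho>) \<theta> \<and>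
        A_nucleus_component 1 Lft Q circ \<sigma> = A_nucleus_component (inv \<tau> 1) v Q star \<rho> \<and>
        A_nucleus_component 3 Lft Q circ \<sigma> = A_nucleus_component (inv \<tau> 3) v Q star \<rho>) \<and>
      (let v = side_of (inv \<tau> 1) in
        A_nucleus Rgt Q circ \<sigma> = conjugate_set (A_nucleus v Q star \<rho>) \<theta> \<and>
        A_nucleus_component 2 Rgt Q circ \<sigma> = A_nucleus_component (inv \<tau> 2) v Q star \<rho> \<and>
        A_nucleus_component 3 Rgt Q circ \<sigma> = A_nucleus_component (inv \<tau> 3) v Q star \<rho>) \<and>
      (let v = side_of (inv \<tau> 3) in
        A_nucleus Mid Q circ \<sigma> = conjugate_set (A_nucleus v Q star \<rho>) \<theta> \<and>
        A_nucleus_component 1 Mid Q circ \<sigma> = A_nucleus_component (inv \<tau> 1) v Q star \<rho> \<and>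
        A_nucleus_component 2 Mid Q circ \<sigma> = A_nucleus_component (inv \<tau> 2) v Q star \<rho>)"
    unfolding Let_def side[symmetric]
    by (intro conjI conj comp) simp_all
qed

end
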